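(* Let $M_1,M_2$ be two closed subspaces of a complex Hilbert space $H\neq\{0\}$. Then $$\omega(P_{M_2}P_{M_1})=\frac12\left(\sqrt{r(P_{M_2}P_{M_1})}+r(P_{M_2}P_{M_1})\right).$$
   Context: For a closed subspace $M$ of $H$, $P_M$ denotes the orthogonal projection of $H$ onto $M$. For a bounded operator $T$ on $H$, $\omega(T)=\sup\{|\langle Tx,x\rangle| : x\in H,\ \|x\|=1\}$ is the numerical radius and $r(T)=\sup\{|z|: z\in\sigma(T)\}$ is the spectral radius. *)

theory Defs
  imports "HOL-Analysis.Analysis"
begin

(* Complex Hilbert spaces as type classes over the real normed spaces of the library; the complex
   structure is required to be compatible with the real one, and the norm is induced by the inner
   product. *)

class complex_vector = real_vector +
  fixes scaleC :: "complex \<Rightarrow> 'a \<Rightarrow> 'a"  (infixr \<open>*\<^sub>C\<close> 75)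
  assumes scaleC_add_right: "a *\<^sub>C (x + y) = a *\<^sub>C x + a *\<^sub>C y"
    and scaleC_add_left: "(a + b) *\<^sub>C x = a *\<^sub>C x + b *\<^sub>C x"
    and scaleC_scaleC: "a *\<^sub>C (b *\<^sub>C x) = (a * b) *\<^sub>C x"
    and scaleC_one: "1 *\<^sub>C x = x"
    and scaleC_of_real: "complex_of_real r *\<^sub>C x = r *\<^sub>R x"

global_interpretation complex_vector:
    vector_space "scaleC :: complex \<Rightarrow> 'a \<Rightarrow> 'a::complex_vector"
  defines csubspace = complex_vector.subspace
  by unfold_locales
    (simp_all add: scaleC_add_right scaleC_add_left scaleC_scaleC scaleC_one)

(* The inner product is linear in its first argument. *)

class complex_inner = complex_vector + real_normed_vector +
  fixes cinner :: "'a \<Rightarrow> 'a \<Rightarrow> complex"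
  assumes cinner_commute: "cinner x y = cnj (cinner y x)"
    and cinner_add_left: "cinner (x + y) z = cinner x z + cinner y z"
    and cinner_scaleC_left: "cinner (c *\<^sub>C x) y = c * cinner x y"
    and cinner_self: "cinner x x = complex_of_real ((norm x)\<^sup>2)"

class complex_hilbert_space = complex_inner + complete_space

definition bounded_clinear ::
    "('a::complex_inner \<Rightarrow> 'b::complex_inner) \<Rightarrow> bool" where
  "bounded_clinear T \<longleftrightarrow> Vector_Spaces.linear scaleC scaleC T \<and> bounded_linear T"

definition orth_proj :: "'a::complex_hilbert_space set \<Rightarrow> 'a \<Rightarrow> 'a" where
  "orth_proj M x = (THE y. y \<in> M \<and> (\<forall>z\<in>M. cinner (x - y) z = 0))"

definition numerical_radius :: "('a::complex_hilbert_space \<Rightarrow> 'a) \<Rightarrow> real" where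
  "numerical_radius T = Sup {cmod (cinner (T x) x) | x. norm x = 1}"

definition spectrum :: "('a::complex_hilbert_space \<Rightarrow> 'a) \<Rightarrow> complex set" where
  "spectrum T = {z. \<not> (\<exists>S. bounded_clinear S \<and>
      S \<circ> (\<lambda>x. T x - z *\<^sub>C x) = id \<and> (\<lambda>x. T x - z *\<^sub>C x) \<circ> S = id)}"

definition spectral_radius :: "('a::complex_hilbert_space \<Rightarrow> 'a) \<Rightarrow> real" where
  "spectral_radius T = Sup {cmod z | z. z \<in> spectrum T}"

end

theory Submission
  imports Defs
begin

text \<open>Write \<open>P\<close> and \<open>Q\<close> for the projections onto the two subspaces, and let
  \<open>c = \<parallel>QP\<parallel>\<close>, the cosine of the smallest angle between the subspaces:
  \<open>|\<langle>p,q\<rangle>| \<le> c \<parallel>p\<parallel> \<parallel>q\<parallel>\<close> for \<open>p\<close> in the range of \<open>P\<close> and \<open>q\<close> in the range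
  of \<open>Q\<close>. Both radii are functions of \<open>c\<close> alone: the spectral radius of \<open>QP\<close> is \<open>c\<^sup>2\<close>
  and the numerical radius is \<open>c (1 + c) / 2\<close>. The identity follows by eliminating \<open>c\<close>.

  Both values are approached along unit vectors \<open>u\<close> in the range of \<open>P\<close> with
  \<open>s = \<parallel>Qu\<parallel>\<close> tending to \<open>c\<close> (lemma \<open>maximising_sequence_exists\<close>).

  Spectral radius. The operator \<open>PQP\<close> has norm at most \<open>c\<^sup>2\<close>, so its resolvent at \<open>z\<close>
  with \<open>|z| > c\<^sup>2\<close> is obtained from Banach's fixed point theorem, and solving
  \<open>QPx - zx = y\<close> reduces to solving \<open>PQPw - zw = Py\<close> for \<open>w = Px\<close>
  (lemma \<open>spectrum_bound\<close>). Conversely, \<open>\<parallel>PQu - c\<^sup>2u\<parallel>\<^sup>2 \<le> c\<^sup>2(c\<^sup>2 - s\<^sup>2)\<close> tends to \<open>0\<close>, so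
  the vectors \<open>Qu\<close> are approximate eigenvectors of \<open>QP\<close> for the value \<open>c\<^sup>2\<close>
  (lemma \<open>c_sq_in_spectrum\<close>).

  Numerical radius. For a unit vector \<open>x\<close>, Buzano's inequality for \<open>Px\<close> and \<open>Qx\<close> bounds
  \<open>t = \<parallel>Px\<parallel> \<parallel>Qx\<parallel>\<close> by \<open>(1 + c) / 2\<close>, and \<open>|\<langle>QPx,x\<rangle>| = |\<langle>Px,Qx\<rangle>| \<le> c t\<close>
  (lemma \<open>cmod_cinner_T_le\<close>). The bound is approached on the bisector of the nearly closest
  directions \<open>u\<close> and \<open>Qu\<close> (lemma \<open>numerical_radius_ge_trial\<close>).\<close>

section \<open>Complex inner products\<close>

lemma cinner_add_right: "cinner x (y + z) = cinner x y + cinner x (z :: 'a::complex_inner)"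
  by (metis cinner_add_left cinner_commute complex_cnj_add)

lemma cinner_scaleC_right: "cinner x (c *\<^sub>C y) = cnj c * cinner x (y :: 'a::complex_inner)"
  by (metis cinner_commute cinner_scaleC_left complex_cnj_mult)

lemma cinner_diff_left: "cinner (x - y) z = cinner x z - cinner y (z :: 'a::complex_inner)"
  by (metis add_diff_cancel_right' cinner_add_left diff_add_cancel)

lemma cinner_diff_right: "cinner x (y - z) = cinner x y - cinner x (z :: 'a::complex_inner)"
  by (metis add_diff_cancel_right' cinner_add_right diff_add_cancel)

lemmas cinner_bilinear =
  cinner_add_left cinner_add_right cinner_diff_left cinner_diff_right
  cinner_scaleC_left cinner_scaleC_right

lemma cinner_zero [simp]: "cinner 0 x = 0" "cinner (x :: 'a::complex_inner) 0 = 0"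
  using cinner_diff_left[of x x x] cinner_diff_right[of x x x] by simp_all

lemma Re_cinner_self: "Re (cinner x x) = (norm (x :: 'a::complex_inner))\<^sup>2"
  by (simp add: cinner_self)

lemma cinner_left_ext:
  fixes x y :: "'a::complex_inner"
  assumes "\<And>z. cinner x z = cinner y z"
  shows "x = y"
proof -
  have "cinner (x - y) (x - y) = 0"
    by (simp add: assms cinner_diff_left)
  then show ?thesis
    by (simp add: cinner_self)
qed

lemma norm_add_sq:
  "(norm (x + y))\<^sup>2 = (norm x)\<^sup>2 + 2 * Re (cinner x y) + (norm (y :: 'a::complex_inner))\<^sup>2"
  using arg_cong[OF cinner_commute[of y x], of Re]
  by (simp add: cinner_bilinear flip: Re_cinner_self)

lemma norm_diff_sq:
  "(norm (x - y))\<^sup>2 = (norm x)\<^sup>2 - 2 * Re (cinner x y) + (norm (y :: 'a::complex_inner))\<^sup>2"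
  using arg_cong[OF cinner_commute[of y x], of Re]
  by (simp add: cinner_bilinear flip: Re_cinner_self)

lemma norm_scaleC: "norm (c *\<^sub>C x) = cmod c * norm (x :: 'a::complex_inner)"
proof -
  have "complex_of_real ((norm (c *\<^sub>C x))\<^sup>2) = (c * cnj c) * cinner x x"
    by (simp only: cinner_self[symmetric] cinner_bilinear mult_ac)
  also have "\<dots> = complex_of_real ((cmod c * norm x)\<^sup>2)"
    by (simp only: complex_norm_square[symmetric] cinner_self power_mult_distrib of_real_mult)
  finally have "(norm (c *\<^sub>C x))\<^sup>2 = (cmod c * norm x)\<^sup>2"
    by (simp only: of_real_eq_iff)
  then show ?thesis
    by (rule power2_eq_imp_eq) simp_all
qed

text \<open>Subtracting from \<open>x\<close> its component along \<open>y\<close> lowers the squared norm by exactly the square of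
  that component. For \<open>y = 0\<close> the convention for division by zero keeps the identity true. It gives
  both the Cauchy-Schwarz inequality and the orthogonality of the error of best approximation.\<close>

lemma norm_diff_component_sq:
  fixes x y :: "'a::complex_inner"
  shows "(norm (x - (cinner x y / complex_of_real ((norm y)\<^sup>2)) *\<^sub>C y))\<^sup>2
    = (norm x)\<^sup>2 - (cmod (cinner x y))\<^sup>2 / (norm y)\<^sup>2"
proof (cases "y = 0")
  case False
  define a where "a = cinner x y / complex_of_real ((norm y)\<^sup>2)"
  have "cinner x (a *\<^sub>C y) = complex_of_real ((cmod (cinner x y))\<^sup>2 / (norm y)\<^sup>2)"
    unfolding a_def of_real_divide complex_norm_square by (simp add: cinner_bilinear)
  then have "Re (cinner x (a *\<^sub>C y)) = (cmod (cinner x y))\<^sup>2 / (norm y)\<^sup>2"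
    by simp
  moreover have "(norm (a *\<^sub>C y))\<^sup>2 = (cmod (cinner x y))\<^sup>2 / (norm y)\<^sup>2"
    using False unfolding a_def
    by (simp add: norm_scaleC norm_divide norm_power power_divide power_mult_distrib field_simps)
  ultimately show ?thesis
    unfolding a_def[symmetric] norm_diff_sq by simp
qed simp

lemma Cauchy_Schwarz_cinner:
  fixes x y :: "'a::complex_inner"
  shows "cmod (cinner x y) \<le> norm x * norm y"
proof (cases "y = 0")
  case False
  have "0 \<le> (norm x)\<^sup>2 - (cmod (cinner x y))\<^sup>2 / (norm y)\<^sup>2"
    by (metis norm_diff_component_sq zero_le_power2)
  then have "(cmod (cinner x y))\<^sup>2 \<le> (norm x * norm y)\<^sup>2"
    using False by (simp add: field_simps)
  then show ?thesis
    by (rule power2_le_imp_le) simp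
qed simp

text \<open>Buzano's strengthening of the Cauchy-Schwarz inequality: the reflection
  \<open>a \<mapsto> 2\<langle>a,x\<rangle>x - a\<close> in the line spanned by the unit vector \<open>x\<close> preserves norms, so that
  Cauchy-Schwarz applies to the reflected vector and \<open>b\<close>.\<close>

lemma Buzano_inequality:
  fixes a b x :: "'a::complex_inner"
  assumes "norm x = 1"
  shows "2 * cmod (cinner a x * cinner x b) \<le> norm a * norm b + cmod (cinner a b)"
proof -
  define r where "r = (2 * cinner a x) *\<^sub>C x - a"
  have "cinner x a * cinner a x = complex_of_real ((cmod (cinner a x))\<^sup>2)"
    by (metis cinner_commute complex_norm_square mult.commute)
  then have "Re (cinner a x * cinner x a) = (cmod (cinner a x))\<^sup>2"
    by (metis Re_complex_of_real mult.commute)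
  then have "(norm r)\<^sup>2 = (norm a)\<^sup>2"
    unfolding r_def norm_diff_sq using assms
    by (simp add: cinner_bilinear norm_scaleC norm_mult power_mult_distrib mult.assoc)
  then have "norm r = norm a"
    by simp
  then have "cmod (cinner r b) \<le> norm a * norm b"
    using Cauchy_Schwarz_cinner[of r b] by simp
  moreover have "2 * (cinner a x * cinner x b) = cinner r b + cinner a b"
    unfolding r_def by (simp add: cinner_bilinear)
  then have "2 * cmod (cinner a x * cinner x b) = cmod (cinner r b + cinner a b)"
    by (metis norm_mult norm_numeral)
  ultimately show ?thesis
    using norm_triangle_ineq[of "cinner r b" "cinner a b"] by simp
qed

lemma bounded_clinearI:
  fixes T :: "'a::complex_inner \<Rightarrow> 'b::complex_inner"
  assumes "\<And>x y. T (x + y) = T x + T y"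
    and "\<And>c x. T (c *\<^sub>C x) = c *\<^sub>C T x"
    and "\<And>x. norm (T x) \<le> norm x * K"
  shows "bounded_clinear T"
  unfolding bounded_clinear_def Vector_Spaces.linear_iff
proof (intro conjI allI)
  show "bounded_linear T"
    by (rule bounded_linear_intro[of _ K]) (simp_all only: assms flip: scaleC_of_real)
qed (simp_all only: assms complex_vector.vector_space_axioms)

section \<open>Orthogonal projections onto closed subspaces\<close>

text \<open>A minimising sequence for the distance to a subspace is Cauchy by the parallelogram law,
  because the midpoint of two of its members again lies in the subspace.\<close>

lemma best_approximation_exists:
  fixes M :: "'a::complex_hilbert_space set"
  assumes "csubspace M" and "closed M"
  shows "\<exists>y\<in>M. \<forall>z\<in>M. norm (x - y) \<le> norm (x - z)"
proof -
  define d where "d = infdist x M"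
  have "M \<noteq> {}"
    using complex_vector.subspace_0[OF assms(1)] by auto
  have lower: "d \<le> norm (x - z)" if "z \<in> M" for z
    using infdist_le[OF that, of x] by (simp add: d_def dist_norm)
  have "0 \<le> d"
    by (simp add: d_def infdist_nonneg)
  have "\<exists>y\<in>M. norm (x - y) < d + inverse (real (Suc n))" for n
  proof (rule ccontr)
    assume "\<not> ?thesis"
    then have "d + inverse (real (Suc n)) \<le> infdist x M"
      unfolding infdist_notempty[OF \<open>M \<noteq> {}\<close>]
      by (intro cINF_greatest \<open>M \<noteq> {}\<close>) (auto simp: dist_norm not_less)
    then show False
      by (simp add: d_def divide_le_eq)
  qed
  then obtain y where y: "\<And>n. y n \<in> M" "\<And>n. norm (x - y n) < d + inverse (real (Suc n))"
    by metis
  have norm_lim: "(\<lambda>n. norm (x - y n)) \<longlonglongrightarrow> d"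
  proof (rule real_tendsto_sandwich)
    show "\<forall>\<^sub>F n in sequentially. d \<le> norm (x - y n)"
      by (intro always_eventually allI lower y(1))
    show "\<forall>\<^sub>F n in sequentially. norm (x - y n) \<le> d + inverse (real (Suc n))"
      by (intro always_eventually allI less_imp_le y(2))
    show "(\<lambda>n. d + inverse (real (Suc n))) \<longlonglongrightarrow> d"
      by (rule LIMSEQ_inverse_real_of_nat_add)
  qed (rule tendsto_const)
  have parallelogram: "(norm (y m - y n))\<^sup>2
      \<le> 2 * ((norm (x - y m))\<^sup>2 - d\<^sup>2) + 2 * ((norm (x - y n))\<^sup>2 - d\<^sup>2)" for m n
  proof -
    define u v where "u = x - y m" and "v = x - y n"
    define w where "w = (1 / 2) *\<^sub>R (y m + y n)"
    have "w \<in> M"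
      unfolding w_def scaleC_of_real[symmetric]
      by (intro complex_vector.subspace_scale complex_vector.subspace_add assms y)
    then have "d \<le> norm (x - w)"
      by (rule lower)
    moreover have "u + v = 2 *\<^sub>R (x - w)"
      unfolding u_def v_def w_def by (simp add: scaleR_2 algebra_simps)
    then have "norm (u + v) = 2 * norm (x - w)"
      by simp
    ultimately have "(2 * d)\<^sup>2 \<le> (norm (u + v))\<^sup>2"
      using \<open>0 \<le> d\<close> by (intro power_mono) auto
    moreover have "(norm (u + v))\<^sup>2 + (norm (u - v))\<^sup>2 = 2 * (norm u)\<^sup>2 + 2 * (norm v)\<^sup>2"
      by (simp add: norm_add_sq norm_diff_sq)
    moreover have "norm (u - v) = norm (y m - y n)"
      unfolding u_def v_def by (simp add: norm_minus_commute)
    ultimately show ?thesis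
      unfolding u_def v_def by (simp add: power_mult_distrib)
  qed
  have "Cauchy y"
  proof (rule metric_CauchyI)
    fix e :: real
    assume "0 < e"
    have "(\<lambda>n. (norm (x - y n))\<^sup>2 - d\<^sup>2) \<longlonglongrightarrow> d\<^sup>2 - d\<^sup>2"
      by (intro tendsto_intros norm_lim)
    then have "eventually (\<lambda>n. (norm (x - y n))\<^sup>2 - d\<^sup>2 < e\<^sup>2 / 4) sequentially"
      using \<open>0 < e\<close> by (intro order_tendstoD) auto
    then obtain N where N: "\<And>n. n \<ge> N \<Longrightarrow> (norm (x - y n))\<^sup>2 - d\<^sup>2 < e\<^sup>2 / 4"
      by (auto simp: eventually_sequentially)
    have "dist (y m) (y n) < e" if "m \<ge> N" "n \<ge> N" for m n
    proof -
      have "(norm (y m - y n))\<^sup>2 < e\<^sup>2"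
        using parallelogram[of m n] N[OF that(1)] N[OF that(2)] by (simp add: field_simps)
      then show ?thesis
        unfolding dist_norm using \<open>0 < e\<close> by (intro power2_less_imp_less[of _ e]) auto
    qed
    then show "\<exists>N. \<forall>m\<ge>N. \<forall>n\<ge>N. dist (y m) (y n) < e"
      by blast
  qed
  then obtain l where l: "y \<longlonglongrightarrow> l"
    by (auto simp: Cauchy_convergent_iff convergent_def)
  have "l \<in> M"
    using closed_sequentially[OF assms(2)] y(1) l by blast
  moreover have "(\<lambda>n. norm (x - y n)) \<longlonglongrightarrow> norm (x - l)"
    by (intro tendsto_intros l)
  then have "norm (x - l) = d"
    using norm_lim LIMSEQ_unique by blast
  ultimately show ?thesis
    using lower by blast
qed

text \<open>If \<open>y\<close> is a best approximation of \<open>x\<close> in \<open>M\<close>, then \<open>x - y\<close> is orthogonal to \<open>M\<close>: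
  a nonzero component along some \<open>z \<in> M\<close> could be subtracted to improve the approximation.\<close>

lemma orth_proj_exists1:
  fixes M :: "'a::complex_hilbert_space set"
  assumes "csubspace M" and "closed M"
  shows "\<exists>!y. y \<in> M \<and> (\<forall>z\<in>M. cinner (x - y) z = 0)"
proof -
  obtain y where y: "y \<in> M" "\<And>z. z \<in> M \<Longrightarrow> norm (x - y) \<le> norm (x - z)"
    using best_approximation_exists[OF assms] by blast
  have orth: "cinner (x - y) z = 0" if "z \<in> M" for z
  proof -
    define a where "a = cinner (x - y) z / complex_of_real ((norm z)\<^sup>2)"
    have "y + a *\<^sub>C z \<in> M"
      by (intro complex_vector.subspace_scale complex_vector.subspace_add assms y that)
    then have "norm (x - y) \<le> norm (x - y - a *\<^sub>C z)"
      using y(2) by (simp add: diff_diff_eq)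
    then have "(norm (x - y))\<^sup>2 \<le> (norm (x - y - a *\<^sub>C z))\<^sup>2"
      by (intro power_mono) auto
    also have "\<dots> = (norm (x - y))\<^sup>2 - (cmod (cinner (x - y) z))\<^sup>2 / (norm z)\<^sup>2"
      unfolding a_def by (rule norm_diff_component_sq)
    finally show ?thesis
      by (auto simp: divide_le_0_iff)
  qed
  have "y' = y" if "y' \<in> M" "\<forall>z\<in>M. cinner (x - y') z = 0" for y'
  proof -
    have "y' - y \<in> M"
      by (intro complex_vector.subspace_diff assms y that)
    then have "cinner (x - y) (y' - y) - cinner (x - y') (y' - y) = 0"
      using orth that by simp
    then have "cinner (y' - y) (y' - y) = 0"
      by (simp flip: cinner_diff_left)
    then show ?thesis
      by (simp add: cinner_self)
  qed
  then show ?thesis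
    using y(1) orth by blast
qed

text \<open>Idempotence and symmetry capture orthogonal projections entirely: linearity and contractivity
  follow from them, so they are derived rather than assumed.\<close>

locale orthogonal_projection =
  fixes P :: "'a::complex_hilbert_space \<Rightarrow> 'a"
  assumes idem [simp]: "P (P x) = P x"
    and adjoint: "cinner (P x) y = cinner x (P y)"

lemma orthogonal_projection_orth_proj:
  assumes "csubspace M" and "closed M"
  shows "orthogonal_projection (orth_proj M)"
proof -
  have P: "orth_proj M x \<in> M" "z \<in> M \<Longrightarrow> cinner (x - orth_proj M x) z = 0" for x z
    using theI'[OF orth_proj_exists1[OF assms, of x]] unfolding orth_proj_def by auto
  have left: "cinner x z = cinner (orth_proj M x) z" if "z \<in> M" for x z
    using P(2)[OF that, of x] by (simp add: cinner_diff_left)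
  show ?thesis
  proof
    fix x y
    show "orth_proj M (orth_proj M x) = orth_proj M x"
      unfolding orth_proj_def[of M "orth_proj M x"]
      by (rule the1_equality[OF orth_proj_exists1[OF assms]]) (simp add: P(1))
    have "cinner (orth_proj M x) y = cnj (cinner y (orth_proj M x))"
      by (rule cinner_commute)
    also have "\<dots> = cnj (cinner (orth_proj M y) (orth_proj M x))"
      using left[OF P(1)] by simp
    also have "\<dots> = cinner (orth_proj M x) (orth_proj M y)"
      by (rule cinner_commute[symmetric])
    also have "\<dots> = cinner x (orth_proj M y)"
      using left[OF P(1)] by simp
    finally show "cinner (orth_proj M x) y = cinner x (orth_proj M y)" .
  qed
qed

context orthogonal_projection
begin

lemma add: "P (x + y) = P x + P y"
  by (rule cinner_left_ext) (simp add: adjoint cinner_bilinear)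

lemma diff: "P (x - y) = P x - P y"
  by (rule cinner_left_ext) (simp add: adjoint cinner_bilinear)

lemma scaleC: "P (c *\<^sub>C x) = c *\<^sub>C P x"
  by (rule cinner_left_ext) (simp add: adjoint cinner_bilinear)

lemma cinner_self_eq: "cinner (P x) x = complex_of_real ((norm (P x))\<^sup>2)"
  by (metis adjoint cinner_self idem)

lemma norm_le: "norm (P x) \<le> norm x"
proof (cases "P x = 0")
  case False
  have "(norm (P x))\<^sup>2 = cmod (cinner (P x) x)"
    by (simp add: cinner_self_eq norm_power)
  also have "\<dots> \<le> norm (P x) * norm x"
    by (rule Cauchy_Schwarz_cinner)
  finally show ?thesis
    using False by (simp add: power2_eq_square)
qed simp

end

section \<open>Criteria for the spectrum\<close>

text \<open>An algebraic inverse of a linear operator is automatically linear, and a lower bound for the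
  operator is a norm bound for the inverse, so a resolvent never has to be exhibited explicitly.\<close>

lemma not_in_spectrumI:
  fixes T :: "'a::complex_hilbert_space \<Rightarrow> 'a"
  assumes add: "\<And>x y. T (x + y) = T x + T y"
    and scale: "\<And>c x. T (c *\<^sub>C x) = c *\<^sub>C T x"
    and surj: "\<And>y. \<exists>x. T x - z *\<^sub>C x = y"
    and bound: "\<And>x. norm x \<le> norm (T x - z *\<^sub>C x) * K"
  shows "z \<notin> spectrum T"
proof -
  define R where "R x = T x - z *\<^sub>C x" for x
  have R_add: "R (x + y) = R x + R y" for x y
    by (simp add: R_def add scaleC_add_right)
  have R_scale: "R (c *\<^sub>C x) = c *\<^sub>C R x" for c x
    by (simp add: R_def scale complex_vector.scale_right_diff_distrib scaleC_scaleC mult.commute)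
  have R_inj: "x = y" if "R x = R y" for x y
  proof -
    have "R (x - y) + R y = R y"
      using that by (simp flip: R_add)
    then have "R (x - y) = 0"
      by simp
    then show ?thesis
      using bound[of "x - y"] by (simp add: R_def)
  qed
  define S where "S y = (SOME x. R x = y)" for y
  have R_S: "R (S y) = y" for y
    using surj[of y] unfolding S_def R_def by (rule someI_ex)
  have S_R: "S (R x) = x" for x
    by (rule R_inj) (rule R_S)
  have "bounded_clinear S"
  proof (rule bounded_clinearI)
    show "S (x + y) = S x + S y" for x y
      by (rule R_inj) (simp add: R_S R_add)
    show "S (c *\<^sub>C x) = c *\<^sub>C S x" for c x
      by (rule R_inj) (simp add: R_S R_scale)
    show "norm (S x) \<le> norm x * K" for x
      using bound[of "S x"] R_S[of x] by (simp add: R_def)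
  qed
  moreover have "S \<circ> R = id" "R \<circ> S = id"
    by (auto simp: S_R R_S)
  ultimately show ?thesis
    unfolding spectrum_def R_def[abs_def] by blast
qed

text \<open>A bounded inverse of \<open>T - z\<close> would map the null sequence of residuals back to the approximate
  eigenvectors and thereby force them to converge to \<open>0\<close>.\<close>

lemma in_spectrumI:
  fixes T :: "'a::complex_hilbert_space \<Rightarrow> 'a"
  assumes lim: "(\<lambda>n. T (x n) - z *\<^sub>C x n) \<longlonglongrightarrow> 0"
    and nonzero: "\<not> x \<longlonglongrightarrow> 0"
  shows "z \<in> spectrum T"
proof (rule ccontr)
  assume "z \<notin> spectrum T"
  then obtain S where S: "bounded_clinear S" "S \<circ> (\<lambda>x. T x - z *\<^sub>C x) = id"
    by (auto simp: spectrum_def)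
  then have "bounded_linear S"
    by (simp add: bounded_clinear_def)
  have "(\<lambda>n. S (T (x n) - z *\<^sub>C x n)) \<longlonglongrightarrow> 0"
    using bounded_linear.tendsto_zero[OF \<open>bounded_linear S\<close> lim] .
  moreover have "S (T (x n) - z *\<^sub>C x n) = x n" for n
    using fun_cong[OF S(2), of "x n"] by simp
  ultimately show False
    using nonzero by simp
qed

text \<open>The map \<open>x \<mapsto> (Ax - y) / z\<close> is a contraction when \<open>|z|\<close> exceeds the norm of \<open>A\<close>;
  its fixed point is the sum of the Neumann series.\<close>

lemma scaleC_fixed_point_exists:
  fixes A :: "'a::complex_hilbert_space \<Rightarrow> 'a"
  assumes diff: "\<And>x y. A (x - y) = A x - A y"
    and bound: "\<And>x. norm (A x) \<le> q * norm x" and "0 \<le> q" "q < cmod z"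
  shows "\<exists>x. z *\<^sub>C x = A x - y"
proof -
  define f where "f x = inverse z *\<^sub>C (A x - y)" for x
  have "z \<noteq> 0"
    using assms by auto
  have "dist (f u) (f v) \<le> q / cmod z * dist u v" for u v
  proof -
    have "f u - f v = inverse z *\<^sub>C A (u - v)"
      by (simp add: f_def diff flip: complex_vector.scale_right_diff_distrib)
    then have "dist (f u) (f v) = norm (A (u - v)) / cmod z"
      by (simp add: dist_norm norm_scaleC norm_inverse divide_inverse mult.commute)
    also have "\<dots> \<le> q * norm (u - v) / cmod z"
      by (intro divide_right_mono bound) simp
    finally show ?thesis
      by (simp add: dist_norm)
  qed
  then have "\<exists>!x. f x = x"
    using assms by (intro banach_fix_type[of "q / cmod z"]) (auto simp: divide_less_eq)
  then obtain x where "f x = x"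
    by blast
  then have "z *\<^sub>C x = z *\<^sub>C f x"
    by simp
  also have "\<dots> = A x - y"
    using \<open>z \<noteq> 0\<close> by (simp add: f_def scaleC_scaleC scaleC_one)
  finally show ?thesis
    by blast
qed

section \<open>The product of two projections\<close>

locale projection_pair = P: orthogonal_projection P + Q: orthogonal_projection Q
  for P Q :: "'a::complex_hilbert_space \<Rightarrow> 'a"
begin

abbreviation "T \<equiv> Q \<circ> P"

text \<open>The operator norm of \<open>QP\<close> is the cosine of the Dixmier angle between the ranges of \<open>P\<close>
  and \<open>Q\<close>.\<close>

definition c :: real where
  "c = onorm T"

lemma bounded_linear_T: "bounded_linear T"
proof (rule bounded_linear_intro[of _ 1])
  show "T (r *\<^sub>R x) = r *\<^sub>R T x" for r x
    by (simp add: P.scaleC Q.scaleC flip: scaleC_of_real)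
  show "norm (T x) \<le> norm x * 1" for x
    using Q.norm_le[of "P x"] P.norm_le[of x] by simp
qed (simp add: P.add Q.add)

lemma c_nonneg: "0 \<le> c"
  unfolding c_def by (rule onorm_pos_le[OF bounded_linear_T])

lemma norm_QP_le: "norm (Q (P x)) \<le> c * norm x"
  using onorm[OF bounded_linear_T, of x] by (simp add: c_def)

lemma cmod_cinner_ranges_le: "cmod (cinner (P x) (Q y)) \<le> c * (norm (P x) * norm (Q y))"
proof -
  have "cinner (P x) (Q y) = cinner (Q (P (P x))) (Q y)"
    by (simp add: Q.adjoint)
  then have "cmod (cinner (P x) (Q y)) \<le> norm (Q (P (P x))) * norm (Q y)"
    by (simp only: Cauchy_Schwarz_cinner)
  also have "\<dots> \<le> (c * norm (P x)) * norm (Q y)"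
    by (intro mult_right_mono norm_QP_le) simp
  finally show ?thesis
    by (simp add: mult.assoc)
qed

lemma norm_PQ_le: "norm (P (Q x)) \<le> c * norm (Q x)"
proof (cases "P (Q x) = 0")
  case False
  have "(norm (P (Q x)))\<^sup>2 = cmod (cinner (P (Q x)) (Q x))"
    by (simp add: P.cinner_self_eq norm_power)
  also have "\<dots> \<le> c * (norm (P (Q x)) * norm (Q x))"
    by (rule cmod_cinner_ranges_le)
  finally show ?thesis
    using False by (simp add: power2_eq_square)
qed (simp add: c_nonneg)

text \<open>Going from the range of \<open>P\<close> to that of \<open>Q\<close> and back costs the factor \<open>c\<close> twice, which
  is why the spectral radius is \<open>c\<^sup>2\<close> and not \<open>c\<close>.\<close>

lemma norm_PQP_le: "norm (P (Q (P x))) \<le> c\<^sup>2 * norm x"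
  using order_trans[OF norm_PQ_le[of "P x"] mult_left_mono[OF norm_QP_le[of x] c_nonneg]]
  by (simp add: power2_eq_square mult.assoc)

text \<open>Projecting near-maximisers of the norm of \<open>T\<close> into the range of \<open>P\<close> does not lengthen
  them, so that the operator norm is approached along unit vectors of that range.\<close>

lemma maximising_sequence_exists:
  assumes "0 < c"
  shows "\<exists>u. (\<forall>n. P (u n) = u n) \<and> (\<forall>n. norm (u n) = 1) \<and> (\<lambda>n. norm (Q (u n))) \<longlonglongrightarrow> c"
proof -
  have "\<forall>n. \<exists>u. P u = u \<and> norm u = 1 \<and> c - inverse (real (Suc n)) \<le> norm (Q u)"
  proof
    fix n
    \<comment> \<open>The maximum with \<open>0\<close> keeps the candidate bound admissible for the operator norm.\<close>
    define d where "d = max 0 (c - inverse (real (Suc n)))"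
    have "0 \<le> d" "d < c"
      using assms by (auto simp: d_def)
    have "\<exists>x. \<not> norm (T x) \<le> d * norm x"
    proof (rule ccontr)
      assume "\<not> ?thesis"
      then have "c \<le> d"
        unfolding c_def using \<open>0 \<le> d\<close> by (intro onorm_bound) auto
      then show False
        using \<open>d < c\<close> by simp
    qed
    then obtain x where x: "d * norm x < norm (Q (P x))"
      by (auto simp: not_le)
    define u where "u = complex_of_real (inverse (norm (P x))) *\<^sub>C P x"
    have "Q 0 = 0"
      using Q.diff[of 0 0] by simp
    moreover have "0 \<le> d * norm x"
      using \<open>0 \<le> d\<close> by simp
    ultimately have "P x \<noteq> 0"
      using x by (metis norm_zero not_le)
    then have "P u = u" "norm u = 1"
      by (simp_all add: u_def P.scaleC norm_scaleC norm_inverse)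
    have "d * norm (P x) \<le> d * norm x"
      using \<open>0 \<le> d\<close> P.norm_le by (intro mult_left_mono)
    then have "d * norm (P x) \<le> norm (Q (P x))"
      using x by simp
    moreover have "norm (Q u) = norm (Q (P x)) / norm (P x)"
      by (simp add: u_def Q.scaleC norm_scaleC norm_inverse divide_inverse)
    ultimately have "d \<le> norm (Q u)"
      using \<open>P x \<noteq> 0\<close> by (simp add: pos_le_divide_eq)
    then show "\<exists>u. P u = u \<and> norm u = 1 \<and> c - inverse (real (Suc n)) \<le> norm (Q u)"
      using \<open>P u = u\<close> \<open>norm u = 1\<close> by (auto simp: d_def)
  qed
  from choice[OF this] obtain u where
    u: "\<And>n. P (u n) = u n" "\<And>n. norm (u n) = 1"
      "\<And>n. c - inverse (real (Suc n)) \<le> norm (Q (u n))"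
    by blast
  have upper: "norm (Q (u n)) \<le> c" for n
    using norm_QP_le[of "u n"] u(1,2)[of n] by simp
  have "(\<lambda>n. norm (Q (u n))) \<longlonglongrightarrow> c"
  proof (rule real_tendsto_sandwich)
    show "\<forall>\<^sub>F n in sequentially. c - inverse (real (Suc n)) \<le> norm (Q (u n))"
      by (intro always_eventually allI u(3))
    show "\<forall>\<^sub>F n in sequentially. norm (Q (u n)) \<le> c"
      by (intro always_eventually allI upper)
    show "(\<lambda>n. c - inverse (real (Suc n))) \<longlonglongrightarrow> c"
      using LIMSEQ_inverse_real_of_nat_add_minus[of c] by simp
  qed (rule tendsto_const)
  with u show ?thesis
    by blast
qed

section \<open>The spectral radius\<close>

text \<open>The bound \<open>\<parallel>QP\<parallel> \<le> c\<close> alone would be too weak. Applying \<open>P\<close> to \<open>QPx - zx = y\<close> turns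
  the equation into one for \<open>Px\<close> with the operator \<open>PQP\<close>, whose norm is at most \<open>c\<^sup>2\<close>; then
  \<open>x\<close> itself is recovered from \<open>zx = Q(Px) - y\<close>.\<close>

lemma spectrum_bound:
  assumes "z \<in> spectrum T"
  shows "cmod z \<le> c\<^sup>2"
proof (rule ccontr)
  assume "\<not> cmod z \<le> c\<^sup>2"
  then have z: "c\<^sup>2 < cmod z" "0 < cmod z"
    using zero_le_power2[of c] by linarith+
  then have "z \<noteq> 0"
    by auto
  have "z \<notin> spectrum T"
  proof (rule not_in_spectrumI)
    fix y
    obtain w where w: "z *\<^sub>C w = P (Q (P w)) - P y"
      using scaleC_fixed_point_exists[of "\<lambda>x. P (Q (P x))" "c\<^sup>2" z "P y"] norm_PQP_le z(1)
      by (auto simp: P.diff Q.diff)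
    have "z *\<^sub>C P w = z *\<^sub>C w"
      by (simp add: w P.diff flip: P.scaleC)
    then have "P w = w"
      using \<open>z \<noteq> 0\<close> by simp
    define x where "x = inverse z *\<^sub>C (Q w - y)"
    have zx: "z *\<^sub>C x = Q w - y"
      using \<open>z \<noteq> 0\<close> by (simp add: x_def scaleC_scaleC scaleC_one)
    have "z *\<^sub>C P x = z *\<^sub>C w"
      using \<open>P w = w\<close> by (simp add: zx w P.diff flip: P.scaleC)
    then have "P x = w"
      using \<open>z \<noteq> 0\<close> by simp
    then show "\<exists>x. T x - z *\<^sub>C x = y"
      by (intro exI[of _ x]) (simp add: zx)
  next
    fix x
    define y where "y = T x - z *\<^sub>C x"
    define k where "k = cmod z - c\<^sup>2"
    have "0 < k"
      using z by (simp add: k_def)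
    have "z *\<^sub>C P x = P (Q (P x)) - P y"
      by (simp add: y_def P.diff P.scaleC)
    then have "cmod z * norm (P x) \<le> c\<^sup>2 * norm (P x) + norm (P y)"
      using norm_triangle_ineq4[of "P (Q (P x))" "P y"] norm_PQP_le[of "P x"]
      by (simp flip: norm_scaleC)
    then have "k * norm (P x) \<le> norm y"
      using P.norm_le[of y] by (simp add: k_def algebra_simps)
    then have Px: "norm (P x) \<le> norm y / k"
      using \<open>0 < k\<close> by (simp add: field_simps)
    have "z *\<^sub>C x = Q (P x) - y"
      by (simp add: y_def)
    then have "cmod z * norm x \<le> norm (Q (P x)) + norm y"
      using norm_triangle_ineq4[of "Q (P x)" y] by (simp flip: norm_scaleC)
    then have "cmod z * norm x \<le> norm y / k + norm y"
      using Px Q.norm_le[of "P x"] by linarith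
    then show "norm x \<le> norm (T x - z *\<^sub>C x) * ((1 / k + 1) / cmod z)"
      unfolding y_def[symmetric] using z(2) by (simp add: field_simps)
  qed (simp_all add: P.add P.scaleC Q.add Q.scaleC)
  then show False
    using assms by simp
qed

text \<open>For \<open>u\<close> in a maximising sequence, \<open>\<langle>PQu,u\<rangle> = \<parallel>Qu\<parallel>\<^sup>2\<close> is close to \<open>c\<^sup>2\<close>, an upper
  bound for the norm of \<open>PQu\<close>; hence \<open>PQu\<close> is close to \<open>c\<^sup>2u\<close>. Applying \<open>Q\<close> gives approximate
  eigenvectors \<open>Qu\<close> of \<open>QP\<close>, which stay away from \<open>0\<close> if \<open>c > 0\<close>. If \<open>c = 0\<close>, the operator
  vanishes and any nonzero vector is an eigenvector.\<close>

lemma c_sq_in_spectrum: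
  assumes "(UNIV :: 'a set) \<noteq> {0}"
  shows "complex_of_real (c\<^sup>2) \<in> spectrum T"
proof (cases "c = 0")
  case True
  then have "T x = 0" for x
    using norm_QP_le[of x] by simp
  obtain a :: 'a where "a \<noteq> 0"
    using assms by auto
  show ?thesis
    using \<open>\<And>x. T x = 0\<close> \<open>a \<noteq> 0\<close> True
    by (intro in_spectrumI[where x = "\<lambda>_. a"]) (simp_all add: LIMSEQ_const_iff)
next
  case False
  then have "0 < c"
    using c_nonneg by simp
  then obtain u where u: "\<And>n. P (u n) = u n" "\<And>n. norm (u n) = 1"
    and lim: "(\<lambda>n. norm (Q (u n))) \<longlonglongrightarrow> c"
    using maximising_sequence_exists by blast
  define e where "e n = P (Q (u n)) - complex_of_real (c\<^sup>2) *\<^sub>C u n" for n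
  have e: "(norm (e n))\<^sup>2 \<le> c\<^sup>2 * (c\<^sup>2 - (norm (Q (u n)))\<^sup>2)" for n
  proof -
    have "cinner (P (Q (u n))) (u n) = complex_of_real ((norm (Q (u n)))\<^sup>2)"
      using Q.cinner_self_eq[of "u n"] by (simp add: P.adjoint u)
    then have "(norm (e n))\<^sup>2 = (norm (P (Q (u n))))\<^sup>2 - 2 * c\<^sup>2 * (norm (Q (u n)))\<^sup>2 + c\<^sup>2 * c\<^sup>2"
      unfolding e_def norm_diff_sq
      by (simp add: cinner_bilinear norm_scaleC u norm_mult power2_eq_square)
    moreover have "(norm (P (Q (u n))))\<^sup>2 \<le> c\<^sup>2 * (norm (Q (u n)))\<^sup>2"
      using power_mono[OF norm_PQ_le[of "u n"], of 2] by (simp add: power_mult_distrib)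
    ultimately show ?thesis
      by (simp add: algebra_simps)
  qed
  have sq_lim: "(\<lambda>n. c\<^sup>2 * (c\<^sup>2 - (norm (Q (u n)))\<^sup>2)) \<longlonglongrightarrow> c\<^sup>2 * (c\<^sup>2 - c\<^sup>2)"
    by (intro tendsto_intros lim)
  have "(\<lambda>n. sqrt (c\<^sup>2 * (c\<^sup>2 - (norm (Q (u n)))\<^sup>2))) \<longlonglongrightarrow> 0"
    using tendsto_real_sqrt[OF sq_lim] by simp
  then have "(\<lambda>n. Q (e n)) \<longlonglongrightarrow> 0"
  proof (rule Lim_null_comparison[rotated], intro always_eventually allI)
    show "norm (Q (e n)) \<le> sqrt (c\<^sup>2 * (c\<^sup>2 - (norm (Q (u n)))\<^sup>2))" for n
      using Q.norm_le[of "e n"] real_le_rsqrt[OF e[of n]] by linarith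
  qed
  moreover have "Q (e n) = T (Q (u n)) - complex_of_real (c\<^sup>2) *\<^sub>C Q (u n)" for n
    by (simp add: e_def Q.diff Q.scaleC)
  moreover have "\<not> (\<lambda>n. Q (u n)) \<longlonglongrightarrow> 0"
    using LIMSEQ_unique[OF lim tendsto_norm_zero] False by blast
  ultimately show ?thesis
    by (intro in_spectrumI[where x = "\<lambda>n. Q (u n)"]) simp_all
qed

lemma spectral_radius_eq:
  assumes "(UNIV :: 'a set) \<noteq> {0}"
  shows "spectral_radius T = c\<^sup>2"
  unfolding spectral_radius_def
proof (rule cSup_eq_maximum)
  show "c\<^sup>2 \<in> {cmod z | z. z \<in> spectrum T}"
    using c_sq_in_spectrum[OF assms] by (force simp: norm_power)
  show "r \<le> c\<^sup>2" if "r \<in> {cmod z | z. z \<in> spectrum T}" for r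
    using that spectrum_bound by blast
qed

section \<open>The numerical radius\<close>

text \<open>Since \<open>\<langle>Px,x\<rangle> = \<parallel>Px\<parallel>\<^sup>2\<close> and \<open>\<langle>x,Qx\<rangle> = \<parallel>Qx\<parallel>\<^sup>2\<close>, Buzano's inequality for \<open>Px\<close> and
  \<open>Qx\<close> reads \<open>2t\<^sup>2 \<le> t + |\<langle>Px,Qx\<rangle>| \<le> t + ct\<close> with \<open>t = \<parallel>Px\<parallel> \<parallel>Qx\<parallel>\<close>.\<close>

lemma cmod_cinner_T_le:
  assumes "norm x = 1"
  shows "cmod (cinner (T x) x) \<le> c * (1 + c) / 2"
proof -
  define t where "t = norm (P x) * norm (Q x)"
  have "cmod (cinner (P x) (Q x)) \<le> c * t"
    unfolding t_def by (rule cmod_cinner_ranges_le)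
  moreover have "cinner (P x) x * cinner x (Q x) = complex_of_real (t\<^sup>2)"
    by (simp add: P.cinner_self_eq Q.cinner_self_eq t_def power_mult_distrib flip: Q.adjoint)
  then have "2 * t\<^sup>2 \<le> t + cmod (cinner (P x) (Q x))"
    using Buzano_inequality[OF assms, of "P x" "Q x"] by (simp add: t_def norm_power norm_mult)
  ultimately have "t * (2 * t) \<le> t * (1 + c)"
    by (simp add: power2_eq_square algebra_simps)
  moreover have "0 \<le> t"
    by (simp add: t_def)
  ultimately have "2 * t \<le> 1 + c"
    using c_nonneg by (cases "t = 0") (auto simp: mult_le_cancel_left)
  then have "c * t \<le> c * ((1 + c) / 2)"
    using c_nonneg by (intro mult_left_mono) auto
  then show ?thesis
    using \<open>cmod (cinner (P x) (Q x)) \<le> c * t\<close> by (simp add: Q.adjoint)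
qed

lemma bdd_above_numerical_range: "bdd_above {cmod (cinner (T x) x) | x. norm x = 1}"
  by (rule bdd_aboveI[of _ "c * (1 + c) / 2"]) (auto dest: cmod_cinner_T_le)

lemma numerical_radius_ge:
  assumes "x \<noteq> 0"
  shows "cmod (cinner (T x) x) / (norm x)\<^sup>2 \<le> numerical_radius T"
  unfolding numerical_radius_def
proof (rule cSup_upper[OF _ bdd_above_numerical_range], intro CollectI exI conjI)
  let ?y = "complex_of_real (inverse (norm x)) *\<^sub>C x"
  show "norm ?y = 1"
    using assms by (simp add: norm_scaleC norm_inverse)
  show "cmod (cinner (T x) x) / (norm x)\<^sup>2 = cmod (cinner (T ?y) ?y)"
    by (simp add: P.scaleC Q.scaleC cinner_bilinear norm_mult norm_inverse
        power2_eq_square divide_inverse mult_ac)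
qed

text \<open>With \<open>s = \<parallel>Qu\<parallel>\<close>, the trial vector \<open>su + Qu\<close> is a multiple of the sum of the unit vectors
  \<open>u\<close> and \<open>Qu / s\<close>, so it bisects the angle between them. The estimate
  \<open>\<parallel>PQu\<parallel> \<ge> |\<langle>PQu,u\<rangle>| = s\<^sup>2\<close> makes its Rayleigh quotient at least \<open>s (1 + s) / 2\<close>.\<close>

lemma numerical_radius_ge_trial:
  assumes "P u = u" and "norm u = 1" and "Q u \<noteq> 0"
  shows "norm (Q u) * (1 + norm (Q u)) / 2 \<le> numerical_radius T"
proof -
  define s where "s = norm (Q u)"
  define w where "w = Q u"
  define x where "x = complex_of_real s *\<^sub>C u + w"
  have "0 < s"
    using assms by (simp add: s_def)
  have [simp]: "Q w = w" "norm w = s"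
    by (simp_all add: w_def s_def)
  have wu: "cinner w u = complex_of_real (s\<^sup>2)"
    unfolding w_def s_def by (rule Q.cinner_self_eq)
  have uw: "cinner u w = complex_of_real (s\<^sup>2)"
    using wu cinner_commute[of u w] by simp
  define p where "p = (norm (P w))\<^sup>2"
  have "cinner (P w) u = complex_of_real (s\<^sup>2)"
    by (simp add: P.adjoint assms wu)
  then have "s\<^sup>2 \<le> norm (P w)"
    using Cauchy_Schwarz_cinner[of "P w" u] assms(2) by (simp add: norm_power)
  then have "s ^ 4 \<le> p"
    using power_mono[of "s\<^sup>2" "norm (P w)" 2] by (simp add: p_def)
  have norm_x: "(norm x)\<^sup>2 = 2 * s\<^sup>2 * (1 + s)"
    unfolding x_def norm_add_sq
    by (simp add: cinner_bilinear norm_scaleC uw assms(2) algebra_simps power2_eq_square)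
  then have "x \<noteq> 0"
    using \<open>0 < s\<close> by auto
  have "Q x = complex_of_real s *\<^sub>C w + w"
    by (simp add: x_def Q.add Q.scaleC flip: w_def)
  moreover have "P x = complex_of_real s *\<^sub>C u + P w"
    by (simp add: x_def P.add P.scaleC assms)
  ultimately have "cinner (T x) x = complex_of_real (s ^ 4 + s ^ 3 + (s + 1) * p)"
    by (simp add: Q.adjoint cinner_bilinear uw P.cinner_self_eq p_def algebra_simps
        power2_eq_square power3_eq_cube power4_eq_xxxx)
  then have "s ^ 4 + s ^ 3 + (s + 1) * p \<le> cmod (cinner (T x) x)"
    by (metis norm_of_real abs_ge_self)
  moreover have "(s + 1) * s ^ 4 \<le> (s + 1) * p"
    using \<open>0 < s\<close> \<open>s ^ 4 \<le> p\<close> by (intro mult_left_mono) auto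
  ultimately have "s ^ 4 + s ^ 3 + (s + 1) * s ^ 4 \<le> cmod (cinner (T x) x)"
    by linarith
  moreover have "s ^ 4 + s ^ 3 + (s + 1) * s ^ 4 = s * (1 + s) / 2 * (norm x)\<^sup>2"
    unfolding norm_x by (simp add: field_simps algebra_simps power2_eq_square power3_eq_cube power4_eq_xxxx)
  ultimately have "s * (1 + s) / 2 \<le> cmod (cinner (T x) x) / (norm x)\<^sup>2"
    using \<open>x \<noteq> 0\<close> by (simp add: pos_le_divide_eq)
  then show ?thesis
    using numerical_radius_ge[OF \<open>x \<noteq> 0\<close>] unfolding s_def by (rule order_trans)
qed

lemma numerical_radius_eq:
  assumes "(UNIV :: 'a set) \<noteq> {0}"
  shows "numerical_radius T = c * (1 + c) / 2"
proof (rule antisym)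
  obtain a :: 'a where "a \<noteq> 0"
    using assms by auto
  then have "\<exists>x :: 'a. norm x = 1"
    by (intro exI[of _ "(1 / norm a) *\<^sub>R a"]) simp
  then show "numerical_radius T \<le> c * (1 + c) / 2"
    unfolding numerical_radius_def by (intro cSup_least) (auto dest: cmod_cinner_T_le)
  have nonneg: "0 \<le> numerical_radius T"
    using numerical_radius_ge[OF \<open>a \<noteq> 0\<close>]
    by (rule order_trans[rotated]) simp
  show "c * (1 + c) / 2 \<le> numerical_radius T"
  proof (cases "c = 0")
    case True
    then show ?thesis
      using nonneg by simp
  next
    case False
    then have "0 < c"
      using c_nonneg by simp
    then obtain u where u: "\<And>n. P (u n) = u n" "\<And>n. norm (u n) = 1"
      and lim: "(\<lambda>n. norm (Q (u n))) \<longlonglongrightarrow> c"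
      using maximising_sequence_exists by blast
    have "norm (Q (u n)) * (1 + norm (Q (u n))) / 2 \<le> numerical_radius T" for n
      using numerical_radius_ge_trial[OF u, of n] nonneg by (cases "Q (u n) = 0") auto
    moreover have "(\<lambda>n. norm (Q (u n)) * (1 + norm (Q (u n))) / 2) \<longlonglongrightarrow> c * (1 + c) / 2"
      by (intro tendsto_intros lim) simp
    ultimately show ?thesis
      by (intro LIMSEQ_le_const2) auto
  qed
qed

end

theorem proposition1p4:
  fixes M1 M2 :: "'a::complex_hilbert_space set"
  assumes "(UNIV :: 'a set) \<noteq> {0}"
    and "csubspace M1" and "closed M1"
    and "csubspace M2" and "closed M2"
  shows "numerical_radius (orth_proj M2 \<circ> orth_proj M1) =
    1 / 2 * (sqrt (spectral_radius (orth_proj M2 \<circ> orth_proj M1))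
      + spectral_radius (orth_proj M2 \<circ> orth_proj M1))"
proof -
  interpret projection_pair "orth_proj M1" "orth_proj M2"
    using assms by (intro projection_pair.intro orthogonal_projection_orth_proj)
  show ?thesis
    using c_nonneg
    by (simp add: numerical_radius_eq[OF assms(1)] spectral_radius_eq[OF assms(1)]
        power2_eq_square algebra_simps)
qed

end
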